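(* Let $\omega\neq1$ be a cube root of unity, $\omega^3=1$, let $X=\mathbf{Z}\cup\omega\mathbf{Z}\cup\omega^2\mathbf{Z}$, and let $$B_X=\Big\{f\in\mathcal{A}_X:\int_{\mathbf{C}}|f(z)|^2e^{-|z|^2}\,dA(z)<\infty\Big\}.$$ Let $K>0$ be a constant for which there is a constant $C>0$ such that for all $f\in\mathcal{A}_X$ and all $q\in\mathbf{C}$ with $|q|>1$, $$|f(q)|\le C\left(\int_{|z|\le K|q|}|f(z)|^2\,dA(z)\right)^{1/2}.$$ Let $f\in B_X$ and set $M_r=\sup_{|z|=r}|f(z)|$. Then for any $t>\frac{K^2}{2}$, $$\limsup_{r\to\infty}\frac{M_r}{e^{tr^2}}=0.$$
   Context: $dA$ is Lebesgue area measure on $\mathbf{C}$. For a discrete set $X\subseteq\mathbf{C}$, $\mathcal{A}_X$ is the set of all continuous functions $f:\mathbf{C}\to\mathbf{C}$ such that for every $a\in X$ and every $r>0$, the restriction $f|_{\{|z-a|=r\}}$ extends continuously to $\{|z-a|\le r\}$ with the extension holomorphic in $\{|z-a|<r\}$. The constant $K$ is the one in the (unweighted, scale-invariant) point evaluation estimate displayed in the claim; the paper asserts, before the theorem, that constants $C,K$ independent of $f$ and $q$ with this property exist for this $X$. *)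

theory Defs
  imports "HOL-Complex_Analysis.Complex_Analysis"
begin

definition disc_extension_space :: "complex set \<Rightarrow> (complex \<Rightarrow> complex) set" where
  "disc_extension_space X = {f. continuous_on UNIV f \<and>
     (\<forall>a\<in>X. \<forall>r>0. \<exists>g. continuous_on (cball a r) g \<and> g holomorphic_on ball a r \<and>
        (\<forall>z\<in>sphere a r. g z = f z))}"

definition weighted_disc_extension_space :: "complex set \<Rightarrow> (complex \<Rightarrow> complex) set" where
  "weighted_disc_extension_space X = {f \<in> disc_extension_space X.
     (\<integral>\<^sup>+z. ennreal ((norm (f z))\<^sup>2 * exp (- (norm z)\<^sup>2)) \<partial>lborel) < \<infinity>}"

(* a genuine supremum for continuous f and r >= 0; the value for r < 0 (empty circle) is immaterial *)
definition max_modulus :: "(complex \<Rightarrow> complex) \<Rightarrow> real \<Rightarrow> real" where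
  "max_modulus f r = (SUP z\<in>sphere 0 r. norm (f z))"

definition three_lines :: "complex \<Rightarrow> complex set" where
  "three_lines \<omega> = \<int> \<union> (\<lambda>z. \<omega> * z) ` \<int> \<union> (\<lambda>z. \<omega>\<^sup>2 * z) ` \<int>"

end

theory Submission
  imports Defs
begin

text \<open>On the disc of radius \<open>R\<close> the Gaussian weight is at least \<open>exp (- R\<^sup>2)\<close>, so passing from the
  weighted to the unweighted square norm there costs at most a factor \<open>exp (R\<^sup>2)\<close>. With \<open>R = K * norm q\<close>
  the point evaluation estimate gives \<open>norm (f q) = O(exp (K\<^sup>2 * (norm q)\<^sup>2 / 2))\<close>.\<close>

text \<open>Continuity supplies the measurability that turns a finite nonnegative integral into
  Bochner integrability. From here on the weighted norm is a real number, not a default value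
  0.\<close>

lemma gaussian_weight_integrable:
  fixes f :: "complex \<Rightarrow> complex"
  assumes "continuous_on UNIV f"
    and "(\<integral>\<^sup>+z. ennreal ((norm (f z))\<^sup>2 * exp (- (norm z)\<^sup>2)) \<partial>lborel) < \<infinity>"
  shows "integrable lborel (\<lambda>z. (norm (f z))\<^sup>2 * exp (- (norm z)\<^sup>2))"
proof (rule integrableI_nonneg)
  have "continuous_on UNIV (\<lambda>z. (norm (f z))\<^sup>2 * exp (- (norm z)\<^sup>2))"
    by (intro continuous_intros assms(1))
  then show "(\<lambda>z. (norm (f z))\<^sup>2 * exp (- (norm z)\<^sup>2)) \<in> borel_measurable lborel"
    using borel_measurable_continuous_onI by auto
qed (use assms(2) in auto)

lemma cball_integral_le_gaussian_weight_integral: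
  fixes f :: "complex \<Rightarrow> complex"
  assumes int: "integrable lborel (\<lambda>z. (norm (f z))\<^sup>2 * exp (- (norm z)\<^sup>2))"
  shows "(LINT z:cball 0 R|lborel. (norm (f z))\<^sup>2)
    \<le> exp (R\<^sup>2) * (LINT z|lborel. (norm (f z))\<^sup>2 * exp (- (norm z)\<^sup>2))"
proof -
  have "(LINT z:cball 0 R|lborel. (norm (f z))\<^sup>2)
      \<le> (LINT z|lborel. exp (R\<^sup>2) * ((norm (f z))\<^sup>2 * exp (- (norm z)\<^sup>2)))"
    unfolding set_lebesgue_integral_def
  \<comment> \<open>Integrability and nonnegativity are checked for the dominating function; a
    non-integrable left side would have integral 0 by convention.\<close>
  proof (rule integral_mono')
    fix z :: complex
    \<comment> \<open>The factor compensates the weight inside the disc; outside it the indicator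
      makes the left side 0.\<close>
    have "1 \<le> exp (R\<^sup>2) * exp (- (norm z)\<^sup>2)" if "norm z \<le> R"
      using power_mono[OF that, of 2] by (simp flip: exp_add)
    then have "(norm (f z))\<^sup>2 * 1 \<le> (norm (f z))\<^sup>2 * (exp (R\<^sup>2) * exp (- (norm z)\<^sup>2))" if "norm z \<le> R"
      using that by (intro mult_left_mono) auto
    then show "indicat_real (cball 0 R) z *\<^sub>R (norm (f z))\<^sup>2
        \<le> exp (R\<^sup>2) * ((norm (f z))\<^sup>2 * exp (- (norm z)\<^sup>2))"
      by (auto simp: indicator_def mult_ac)
  qed (use int in auto)
  then show ?thesis by simp
qed

theorem theorem3:
  fixes \<omega> :: complex and X :: "complex set" and K t :: real and f :: "complex \<Rightarrow> complex"
  assumes "\<omega> ^ 3 = 1" and "\<omega> \<noteq> 1"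
    and "X = three_lines \<omega>"
    and "K > 0"
    and "\<exists>C>0. \<forall>h \<in> disc_extension_space X. \<forall>q. norm q > 1 \<longrightarrow>
           norm (h q) \<le> C * sqrt (LINT z:cball 0 (K * norm q)|lborel. (norm (h z))\<^sup>2)"
    and "f \<in> weighted_disc_extension_space X"
    and "t > K\<^sup>2 / 2"
  shows "Limsup at_top (\<lambda>r::real. ereal (max_modulus f r / exp (t * r\<^sup>2))) = 0"
proof -
  define I where "I = (LINT z|lborel. (norm (f z))\<^sup>2 * exp (- (norm z)\<^sup>2))"
  obtain C where "C > 0" and C: "\<And>h q. h \<in> disc_extension_space X \<Longrightarrow> norm q > 1 \<Longrightarrow>
      norm (h q) \<le> C * sqrt (LINT z:cball 0 (K * norm q)|lborel. (norm (h z))\<^sup>2)"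
    using assms(5) by blast
  have f: "f \<in> disc_extension_space X"
    and int: "integrable lborel (\<lambda>z. (norm (f z))\<^sup>2 * exp (- (norm z)\<^sup>2))"
    using assms(6) by (auto simp: weighted_disc_extension_space_def disc_extension_space_def
        intro!: gaussian_weight_integrable)
  have pointwise: "norm (f q) \<le> C * sqrt I * exp (K\<^sup>2 / 2 * (norm q)\<^sup>2)" if "norm q > 1" for q
  proof -
    \<comment> \<open>Writing the factor as a square lets the square root halve the exponent: this
      is where the threshold \<open>K\<^sup>2 / 2\<close> for \<open>t\<close> comes from.\<close>
    have "exp ((K * norm q)\<^sup>2) = (exp (K\<^sup>2 / 2 * (norm q)\<^sup>2))\<^sup>2"
      by (simp add: power_mult_distrib flip: exp_of_nat_mult)
    then have "sqrt (exp ((K * norm q)\<^sup>2) * I) = exp (K\<^sup>2 / 2 * (norm q)\<^sup>2) * sqrt I"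
      by (simp add: real_sqrt_mult)
    moreover have "sqrt (LINT z:cball 0 (K * norm q)|lborel. (norm (f z))\<^sup>2)
        \<le> sqrt (exp ((K * norm q)\<^sup>2) * I)"
      unfolding I_def by (intro real_sqrt_le_mono cball_integral_le_gaussian_weight_integral int)
    ultimately have "C * sqrt (LINT z:cball 0 (K * norm q)|lborel. (norm (f z))\<^sup>2)
        \<le> C * (exp (K\<^sup>2 / 2 * (norm q)\<^sup>2) * sqrt I)"
      using \<open>C > 0\<close> by (intro mult_left_mono) auto
    with C[OF f that] show ?thesis by (simp add: mult_ac)
  qed
  \<comment> \<open>The restriction \<open>r > 1\<close> is inherited from the point evaluation
    estimate and is harmless as \<open>r\<close> tends to infinity. The lower bound is the other
    half of the squeeze below.\<close>
  have bounds: "0 \<le> max_modulus f r \<and> max_modulus f r \<le> C * sqrt I * exp (K\<^sup>2 / 2 * r\<^sup>2)"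
    if "r > 1" for r
  proof -
    have le: "norm (f z) \<le> C * sqrt I * exp (K\<^sup>2 / 2 * r\<^sup>2)" if "z \<in> sphere 0 r" for z
      using pointwise[of z] that \<open>r > 1\<close> by simp
    \<comment> \<open>A real supremum is meaningful only over a nonempty bounded set: this point
      shows that the circle is nonempty, and \<open>le\<close> bounds the values on it.\<close>
    have mem: "of_real r \<in> sphere (0::complex) r"
      using \<open>r > 1\<close> by simp
    have "bdd_above ((\<lambda>z. norm (f z)) ` sphere 0 r)"
      using le by (rule bdd_aboveI2)
    then have "norm (f (of_real r)) \<le> max_modulus f r"
      unfolding max_modulus_def using mem by (rule cSUP_upper[rotated])
    then have "0 \<le> max_modulus f r"
      using norm_ge_zero order_trans by blast
    moreover have "max_modulus f r \<le> C * sqrt I * exp (K\<^sup>2 / 2 * r\<^sup>2)"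
      unfolding max_modulus_def using mem by (intro cSUP_least le) auto
    ultimately show ?thesis by simp
  qed
  have "((\<lambda>r. max_modulus f r / exp (t * r\<^sup>2)) \<longlongrightarrow> 0) at_top"
  proof (rule tendsto_sandwich[OF _ _ tendsto_const])
    show "eventually (\<lambda>r. 0 \<le> max_modulus f r / exp (t * r\<^sup>2)) at_top"
      using eventually_gt_at_top[of 1] by eventually_elim (simp add: bounds)
    show "eventually (\<lambda>r. max_modulus f r / exp (t * r\<^sup>2)
        \<le> C * sqrt I * exp (- ((t - K\<^sup>2 / 2) * r\<^sup>2))) at_top"
      using eventually_gt_at_top[of 1]
    proof eventually_elim
      case (elim r)
      \<comment> \<open>Dividing the growth bound by \<open>exp (t * r\<^sup>2)\<close> leaves a
        Gaussian, which decays because \<open>t - K\<^sup>2 / 2\<close> is positive.\<close>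
      have "exp (- ((t - K\<^sup>2 / 2) * r\<^sup>2)) = exp (K\<^sup>2 / 2 * r\<^sup>2) / exp (t * r\<^sup>2)"
        by (simp add: algebra_simps flip: exp_diff)
      then show ?case
        using bounds[OF elim] divide_right_mono[of _ _ "exp (t * r\<^sup>2)"] by fastforce
    qed
    have "filterlim (\<lambda>r. (t - K\<^sup>2 / 2) * r\<^sup>2) at_top at_top"
      using assms(7) by (intro filterlim_tendsto_pos_mult_at_top[OF tendsto_const]
          filterlim_pow_at_top filterlim_ident) auto
    then have "((\<lambda>r. exp (- ((t - K\<^sup>2 / 2) * r\<^sup>2))) \<longlongrightarrow> 0) at_top"
      by (intro filterlim_compose[OF exp_at_bot])
        (simp add: filterlim_uminus_at_bot)
    then show "((\<lambda>r. C * sqrt I * exp (- ((t - K\<^sup>2 / 2) * r\<^sup>2))) \<longlongrightarrow> 0) at_top"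
      by (rule tendsto_mult_right_zero)
  qed
  then have "((\<lambda>r. ereal (max_modulus f r / exp (t * r\<^sup>2))) \<longlongrightarrow> 0) at_top"
    by (simp add: zero_ereal_def)
  \<comment> \<open>The quotient has a genuine limit, and \<open>at_top\<close> on the reals is a
    nontrivial filter, so the upper limit equals it.\<close>
  then show ?thesis
    by (intro lim_imp_Limsup) auto
qed

end
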